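(* Let $G$ be a finite group, $H$ a subgroup, and $S\subset G$ with $S_H=S\cap H$ symmetric; let $S_O=S\setminus H$. The pair graph $\mathcal{G}(G,H,S)$ is connected if and only if \[\langle H\cap (S_H\cup S_O S_O^{-1})\rangle = H\] and $S$ contains representatives of all the right cosets of $H$ different from the coset $H$.
   Context: A subset $X\subset G$ is symmetric if $X^{-1}=X$. The group-subgroup pair graph $\mathcal{G}(G,H,S)$ is the undirected graph with vertex set $G$ whose edges are exactly the pairs $\{h,hs\}$ with $h\in H$, $s\in S$. Here $S_OS_O^{-1}=\{st^{-1}: s,t\in S_O\}$ and $\langle X\rangle$ denotes the subgroup generated by $X$. *)

theory Defs
  imports "HOL-Algebra.Generated_Groups" "HOL-Algebra.Coset" "Graph_Theory.Digraph_Component"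
begin

text \<open>
  An undirected graph is represented, as usual in \<^theory>\<open>Graph_Theory.Digraph\<close>, by a
  symmetric digraph: the edge with ends \<open>h\<close> and \<open>h s\<close> becomes the two arcs \<open>(h, h s)\<close> and
  \<open>(h s, h)\<close>. If \<open>\<one> \<in> S\<close> these coincide and form a loop at \<open>h\<close>.
\<close>

definition group_subgroup_pair_graph ::
    "('a, 'b) monoid_scheme \<Rightarrow> 'a set \<Rightarrow> 'a set \<Rightarrow> 'a pair_pre_digraph" where
  "group_subgroup_pair_graph G H S =
     \<lparr> pverts = carrier G,
       parcs = (\<Union>h\<in>H. \<Union>s\<in>S. {(h, h \<otimes>\<^bsub>G\<^esub> s), (h \<otimes>\<^bsub>G\<^esub> s, h)}) \<rparr>"

lemma pair_pseudo_graph_group_subgroup_pair_graph: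
  assumes "group G" "finite (carrier G)" "subgroup H G" "S \<subseteq> carrier G"
  shows "pair_pseudo_graph (group_subgroup_pair_graph G H S)"
proof -
  interpret group G by fact
  have H: "h \<in> carrier G" if "h \<in> H" for h
    using subgroup.mem_carrier[OF assms(3) that] .
  have S: "s \<in> carrier G" if "s \<in> S" for s
    using assms(4) that by blast
  have fin: "finite H" "finite S"
    using assms(2,4) H by (auto intro: finite_subset)
  show ?thesis
    by unfold_locales
      (auto simp: group_subgroup_pair_graph_def symmetric_def sym_def assms(2) fin H S)
qed

end

theory Submission
  imports Defs
begin

text \<open>
  The vertices reachable from \<open>\<one>\<close> are \<open>K\<close> together with \<open>K S\<^sub>O\<close>, where \<open>K\<close> is the subgroup
  generated by \<open>H \<inter> (S\<^sub>H \<union> S\<^sub>O S\<^sub>O\<inverse>)\<close>: a detour \<open>k \<rightarrow> k s \<rightarrow> k s t\<inverse>\<close> through a vertex outside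
  \<open>H\<close> multiplies \<open>k\<close> by an element of \<open>S\<^sub>O S\<^sub>O\<inverse>\<close>, and this element lies in \<open>H\<close> because both ends
  of the detour do. A vertex \<open>x\<close> outside \<open>H\<close> has a neighbour exactly if \<open>S\<close> meets \<open>H x\<close>.
\<close>

text \<open>Walks in a symmetric digraph can be reversed, so any two vertices are joined through
  \<open>r\<close>. The root also supplies the nonempty vertex set that connectedness
  demands.\<close>

lemma (in wf_digraph) connected_iff_reachable_from:
  assumes "symmetric G" "r \<in> verts G"
  shows "connected G \<longleftrightarrow> (\<forall>v \<in> verts G. r \<rightarrow>\<^sup>* v)"
proof
  assume "connected G"
  then show "\<forall>v \<in> verts G. r \<rightarrow>\<^sup>* v"
    using symmetric_connected_imp_strongly_connected[OF assms(1)] assms(2)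
    by (auto simp: strongly_connected_def)
next
  assume *: "\<forall>v \<in> verts G. r \<rightarrow>\<^sup>* v"
  show "connected G"
  proof (rule connectedI)
    fix u v assume "u \<in> verts G" "v \<in> verts G"
    then have "r \<rightarrow>\<^sup>* u" "r \<rightarrow>\<^sup>* v" using * by auto
    then show "u \<rightarrow>\<^sup>*\<^bsub>mk_symmetric G\<^esub> v"
      using symmetric_reachable[OF assms(1)] reachable_trans reachable_mk_symmetricI by blast
  qed (use assms(2) in auto)
qed

lemma group_subgroup_pair_graph_arc_iff:
  "(u, v) \<in> parcs (group_subgroup_pair_graph G H S) \<longleftrightarrow>
     (\<exists>h \<in> H. \<exists>s \<in> S. u = h \<and> v = h \<otimes>\<^bsub>G\<^esub> s \<or> u = h \<otimes>\<^bsub>G\<^esub> s \<and> v = h)"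
  by (auto simp: group_subgroup_pair_graph_def)

locale group_subgroup_pair = group G for G (structure) +
  fixes H S
  assumes subgroup_H: "subgroup H G" and S_carrier: "S \<subseteq> carrier G"
begin

abbreviation arcs_rel where
  "arcs_rel \<equiv> parcs (group_subgroup_pair_graph G H S)"

abbreviation gens where
  "gens \<equiv> H \<inter> ((S \<inter> H) \<union> ((S - H) <#> set_inv (S - H)))"

lemma H_carrier: "h \<in> H \<Longrightarrow> h \<in> carrier G"
  using subgroup.mem_carrier[OF subgroup_H] .

lemma S_in_carrier: "s \<in> S \<Longrightarrow> s \<in> carrier G"
  using S_carrier by blast

lemma H_mult_iff:
  assumes "h \<in> H" "x \<in> carrier G"
  shows "h \<otimes> x \<in> H \<longleftrightarrow> x \<in> H"
proof
  assume "h \<otimes> x \<in> H"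
  then have "inv h \<otimes> (h \<otimes> x) \<in> H"
    using assms subgroup_H by (meson subgroup.m_closed subgroup.m_inv_closed)
  then show "x \<in> H" using assms H_carrier by (simp add: inv_solve_left m_assoc[symmetric])
qed (use assms subgroup_H in \<open>simp add: subgroup.m_closed\<close>)

lemma gens_iff:
  "g \<in> gens \<longleftrightarrow> g \<in> S \<inter> H \<or> g \<in> H \<and> (\<exists>s \<in> S - H. \<exists>t \<in> S - H. g = s \<otimes> inv t)"
  by (auto simp: set_mult_def SET_INV_def)

lemma generate_subset: "generate G gens \<subseteq> H"
  by (rule generate_subgroup_incl[OF _ subgroup_H]) auto

lemma generate_carrier: "k \<in> generate G gens \<Longrightarrow> k \<in> carrier G"
  using generate_subset H_carrier by blast

text \<open>Since \<open>k\<close> lies in \<open>H\<close>, it cancels from the last hypothesis,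
  which makes \<open>s \<otimes> inv t\<close> itself a generator.\<close>

lemma generate_mult_inv:
  assumes "k \<in> generate G gens" "s \<in> S - H" "t \<in> S - H" "k \<otimes> s \<otimes> inv t \<in> H"
  shows "k \<otimes> s \<otimes> inv t \<in> generate G gens"
proof -
  have c: "k \<in> H" "k \<in> carrier G" "s \<in> carrier G" "t \<in> carrier G"
    using assms generate_subset generate_carrier S_in_carrier by auto
  then have "s \<otimes> inv t \<in> H"
    using assms(4) H_mult_iff[of k "s \<otimes> inv t"] by (simp add: m_assoc)
  then have "s \<otimes> inv t \<in> gens" using assms gens_iff by blast
  then have "k \<otimes> (s \<otimes> inv t) \<in> generate G gens"
    by (intro generate.eng[OF assms(1)] generate.incl)
  then show ?thesis using c by (simp add: m_assoc)
qed

text \<open>An invariant preserved along every arc of a walk. Membership in \<open>H\<close> decides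
  which alternative holds, since elements of \<open>S - H\<close> move \<open>H\<close> off
  itself.\<close>

lemma reachable_from_one:
  assumes "(\<one>, v) \<in> arcs_rel\<^sup>*"
  shows "v \<in> generate G gens \<or> (\<exists>k \<in> generate G gens. \<exists>s \<in> S - H. v = k \<otimes> s)"
  using assms
proof (induction rule: rtrancl_induct)
  case base
  show ?case by (simp add: generate.one)
next
  case (step y z)
  let ?K = "generate G gens"
  have KH: "k \<in> H" if "k \<in> ?K" for k using that generate_subset by auto
  from step.hyps(2) obtain h s where hs: "h \<in> H" "s \<in> S"
    and yz: "y = h \<and> z = h \<otimes> s \<or> y = h \<otimes> s \<and> z = h"
    unfolding group_subgroup_pair_graph_arc_iff by blast
  have c: "h \<in> carrier G" "s \<in> carrier G" using hs H_carrier S_in_carrier by auto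
  have sK: "s \<in> ?K" if "s \<in> H" using that hs by (intro generate.incl) auto
  \<comment> \<open>Separates the two alternatives of the induction hypothesis.\<close>
  have outside: "k \<otimes> t \<notin> H" if "k \<in> ?K" "t \<in> S - H" for k t
    using that KH H_mult_iff S_in_carrier by blast
  from yz show ?case
  proof (elim disjE conjE)
    assume e: "y = h" "z = h \<otimes> s"
    with step.IH hs outside have h: "h \<in> ?K" by blast
    show ?thesis
    proof (cases "s \<in> H")
      case True
      then show ?thesis using e(2) generate.eng[OF h sK] by simp
    next
      case False
      then show ?thesis using e(2) h hs(2) by (intro disjI2 bexI[of _ h] bexI[of _ s]) auto
    qed
  next
    assume e: "y = h \<otimes> s" "z = h"
    then have h: "h = y \<otimes> inv s" using c by (simp add: m_assoc)
    show ?thesis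
    proof (cases "s \<in> H")
      case True
      then have "y \<in> H" using e hs c H_mult_iff by blast
      with step.IH outside have "y \<in> ?K" by blast
      moreover have "inv s \<in> ?K" using True hs by (intro generate.inv) auto
      ultimately have "y \<otimes> inv s \<in> ?K" by (rule generate.eng)
      then show ?thesis using e(2) h by simp
    next
      case False
      then have "y \<notin> H" using e hs c H_mult_iff by blast
      \<comment> \<open>The walk may have entered \<open>y\<close> through \<open>t\<close> and
        leave it through a different \<open>s\<close>; the net effect on \<open>k\<close> is
        multiplication by \<open>t \<otimes> inv s\<close>.\<close>
      with step.IH KH obtain k t where kt: "k \<in> ?K" "t \<in> S - H" "y = k \<otimes> t" by blast
      have "k \<otimes> t \<otimes> inv s \<in> ?K"
        by (rule generate_mult_inv) (use kt hs h[symmetric] False in simp_all)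
      then show ?thesis using e(2) h kt(3) by simp
    qed
  qed
qed

lemma sym_arcs_rel: "sym arcs_rel"
  by (auto simp: sym_def group_subgroup_pair_graph_arc_iff)

text \<open>A generator \<open>s \<otimes> inv t\<close> is realised by the walk from
  \<open>h\<close> over \<open>h \<otimes> s\<close> to \<open>h \<otimes> g\<close>.\<close>

lemma reachable_mult_gens:
  assumes "g \<in> gens" "h \<in> H"
  shows "(h, h \<otimes> g) \<in> arcs_rel\<^sup>*"
proof -
  from assms(1) consider "g \<in> S" | s t where "g \<in> H" "s \<in> S" "t \<in> S" "g = s \<otimes> inv t"
    unfolding gens_iff by blast
  then show ?thesis
  proof cases
    case 1
    then show ?thesis using assms(2) group_subgroup_pair_graph_arc_iff by fast
  next
    case 2
    then have "(h, h \<otimes> s) \<in> arcs_rel"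
      using assms(2) group_subgroup_pair_graph_arc_iff by fast
    \<comment> \<open>Needed for the second arc, which must have an end in \<open>H\<close>; it is
      then traversed from its end \<open>h \<otimes> g \<otimes> t\<close>.\<close>
    moreover have "h \<otimes> g \<in> H"
      using 2(1) assms(2) subgroup_H by (simp add: subgroup.m_closed)
    then have "(h \<otimes> g \<otimes> t, h \<otimes> g) \<in> arcs_rel"
      using 2(3) group_subgroup_pair_graph_arc_iff by fast
    moreover have "h \<otimes> g \<otimes> t = h \<otimes> s"
      using 2 assms(2) H_carrier S_in_carrier by (simp add: m_assoc)
    ultimately show ?thesis by (metis r_into_rtrancl rtrancl_into_rtrancl)
  qed
qed

text \<open>The start \<open>h\<close> is kept arbitrary because a product is reached by two walks,
  the second of which starts at \<open>h \<otimes> g1\<close>.\<close>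

lemma reachable_mult_generate:
  assumes "g \<in> generate G gens" "h \<in> H"
  shows "(h, h \<otimes> g) \<in> arcs_rel\<^sup>*"
  using assms
proof (induction arbitrary: h rule: generate.induct)
  case one
  then show ?case using H_carrier by simp
next
  case (incl g)
  then show ?case by (rule reachable_mult_gens)
next
  case (inv g)
  then have c: "g \<in> H" "g \<in> carrier G" "h \<in> carrier G" using H_carrier by auto
  \<comment> \<open>The walk for \<open>g\<close> starting at \<open>h \<otimes> inv g\<close> ends
    at \<open>h\<close>; its reverse is the walk wanted.\<close>
  then have "h \<otimes> inv g \<in> H"
    using inv.prems subgroup_H by (simp add: subgroup.m_closed subgroup.m_inv_closed)
  from reachable_mult_gens[OF inv.hyps this]
  have "(h \<otimes> inv g, h) \<in> arcs_rel\<^sup>*" using c by (simp add: m_assoc)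
  then show ?case using sym_rtrancl[OF sym_arcs_rel] by (meson symD)
next
  case (eng g1 g2)
  then have g: "g1 \<in> H" "g2 \<in> H" using generate_subset by auto
  then have "h \<otimes> g1 \<in> H" using eng.prems subgroup_H by (simp add: subgroup.m_closed)
  then have "(h, h \<otimes> g1) \<in> arcs_rel\<^sup>*" "(h \<otimes> g1, h \<otimes> g1 \<otimes> g2) \<in> arcs_rel\<^sup>*"
    using eng by auto
  then show ?case using g eng.prems H_carrier by (simp add: m_assoc)
qed

lemma all_reachable_iff:
  "(\<forall>v \<in> carrier G. (\<one>, v) \<in> arcs_rel\<^sup>*) \<longleftrightarrow>
     generate G gens = H \<and> (\<forall>C \<in> rcosets H. C \<noteq> H \<longrightarrow> S \<inter> C \<noteq> {})"
proof (intro iffI conjI ballI impI)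
  assume all: "\<forall>v \<in> carrier G. (\<one>, v) \<in> arcs_rel\<^sup>*"
  show "generate G gens = H"
  proof
    show "H \<subseteq> generate G gens"
    proof
      fix h assume h: "h \<in> H"
      then have "(\<one>, h) \<in> arcs_rel\<^sup>*" using all H_carrier by blast
      moreover have "k \<otimes> s \<notin> H" if "k \<in> generate G gens" "s \<in> S - H" for k s
        using that generate_subset H_mult_iff S_in_carrier by blast
      ultimately show "h \<in> generate G gens" using reachable_from_one h by blast
    qed
  qed (rule generate_subset)
  fix C assume C: "C \<in> rcosets H" "C \<noteq> H"
  then obtain x where x: "x \<in> carrier G" "C = H #> x" by (auto simp: RCOSETS_def)
  have "x \<notin> H" using C x coset_join2[OF _ subgroup_H] by blast
  \<comment> \<open>The first alternative of the invariant would put \<open>x\<close> into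
    \<open>H\<close>. The remaining one writes \<open>x\<close> as \<open>k \<otimes> s\<close>, so
    \<open>s\<close> represents the coset of \<open>x\<close>.\<close>
  then obtain k s where ks: "k \<in> H" "s \<in> S" "x = k \<otimes> s"
    using reachable_from_one all x(1) generate_subset by blast
  then have "s = inv k \<otimes> x"
    using H_carrier S_in_carrier by (simp add: m_assoc[symmetric])
  then have "s \<in> C"
    using ks x subgroup_H by (auto simp: r_coset_def subgroup.m_inv_closed)
  then show "S \<inter> C \<noteq> {}" using ks by blast
next
  assume *: "generate G gens = H \<and> (\<forall>C \<in> rcosets H. C \<noteq> H \<longrightarrow> S \<inter> C \<noteq> {})"
  have H: "(\<one>, h) \<in> arcs_rel\<^sup>*" if "h \<in> H" for h
    using reachable_mult_generate[of h \<one>] * that subgroup_H H_carrier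
    by (simp add: subgroup.one_closed)
  fix v assume v: "v \<in> carrier G"
  show "(\<one>, v) \<in> arcs_rel\<^sup>*"
  proof (cases "v \<in> H")
    case False
    have "H #> v \<in> rcosets H" using v by (auto simp: RCOSETS_def)
    moreover have "H #> v \<noteq> H" using False v rcos_self[OF v subgroup_H] by blast
    ultimately obtain s where "s \<in> S" "s \<in> H #> v" using * by blast
    then obtain h where h: "h \<in> H" "s = h \<otimes> v" by (auto simp: r_coset_def)
    \<comment> \<open>The coset representative \<open>s\<close> makes \<open>v\<close> a neighbour
      of \<open>inv h\<close>, which lies in \<open>H\<close> and is already reached.\<close>
    then have "v = inv h \<otimes> s" using v H_carrier by (simp add: m_assoc[symmetric])
    moreover have "inv h \<in> H" using h subgroup_H by (simp add: subgroup.m_inv_closed)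
    ultimately have "(inv h, v) \<in> arcs_rel"
      using \<open>s \<in> S\<close> group_subgroup_pair_graph_arc_iff by fast
    with H[OF \<open>inv h \<in> H\<close>] show ?thesis by (rule rtrancl_into_rtrancl)
  qed (rule H)
qed

end

theorem theorem3p3:
  fixes G :: "('a, 'b) monoid_scheme" (structure) and H S :: "'a set"
  assumes "group G" and "finite (carrier G)"
    and "subgroup H G"
    and "S \<subseteq> carrier G"
    and "set_inv (S \<inter> H) = S \<inter> H"
  shows "Digraph_Component.connected (group_subgroup_pair_graph G H S) \<longleftrightarrow>
    generate G (H \<inter> ((S \<inter> H) \<union> ((S - H) <#> set_inv (S - H)))) = H \<and>
    (\<forall>C \<in> rcosets H. C \<noteq> H \<longrightarrow> S \<inter> C \<noteq> {})"
proof -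
  interpret group_subgroup_pair G H S
    using assms by (simp add: group_subgroup_pair_def group_subgroup_pair_axioms_def)
  let ?P = "group_subgroup_pair_graph G H S"
  interpret P: pair_pseudo_graph ?P
    using assms by (intro pair_pseudo_graph_group_subgroup_pair_graph)
  have verts: "pverts ?P = carrier G" by (simp add: group_subgroup_pair_graph_def)
  have "Digraph_Component.connected ?P \<longleftrightarrow> (\<forall>v \<in> carrier G. \<one> \<rightarrow>\<^sup>*\<^bsub>with_proj ?P\<^esub> v)"
    using P.connected_iff_reachable_from[OF P.sym_arcs, of \<one>] verts by simp
  also have "\<dots> \<longleftrightarrow> (\<forall>v \<in> carrier G. (\<one>, v) \<in> arcs_rel\<^sup>*)"
    \<comment> \<open>From a genuine vertex such as \<open>\<one>\<close>, reachability in the graph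
      is the reflexive transitive closure of its arcs.\<close>
    using P.reachable_conv'[of \<one>] verts by simp
  also note all_reachable_iff
  finally show ?thesis .
qed

end
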